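(* Let $p\in[0,1/2]$ and $\epsilon\in[0,1]$. For any amount of shared randomness (from none to infinite), the channel $\mathrm{BSC}(p)$ can be exactly simulated from $\mathrm{BEC}(\epsilon)$ if and only if $p\ge\epsilon/2$. In particular, shared randomness is not helpful in this exact simulation problem.
   Context: $\mathrm{BSC}(p)$ is the binary symmetric channel with crossover probability $p$. $\mathrm{BEC}(\epsilon)$ is the binary erasure channel with erasure probability $\epsilon$. Exact simulation: $p(y|x)$ can be exactly simulated from $p(\tilde y|\tilde x)$ if for some $n$ there are a shared random variable $\omega$ (independent of the input $x^n$), a stochastic encoder $q^{\mathrm{enc}}(\tilde x^n|x^n,\omega)$ and a stochastic decoder $q^{\mathrm{dec}}(y^n|\tilde y^n,\omega)$ such that the induced channel $$q(y^n|x^n)=\sum_{\omega}p(\omega)\sum_{\tilde x^n,\tilde y^n}q^{\mathrm{enc}}(\tilde x^n|x^n,\omega)\Big(\prod_{i=1}^n p(\tilde y_i|\tilde x_i)\Big)q^{\mathrm{dec}}(y^n|\tilde y^n,\omega)$$ satisfies $q(y^n|x^n)=\prod_{i=1}^n p(y_i|x_i)$ for all $x^n,y^n$. Shared randomness of rate $R\ge0$ means that $\omega$ is uniform on $[1:2^{nR}]=\{1,\dots,2^{nR}\}$ (with $2^{nR}$ understood as an integer). $R=0$ means no shared randomness ($\omega$ constant). Infinite shared randomness means that $\omega$ may be any finite-valued random variable with arbitrary distribution. *)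

theory Defs
  imports "HOL-Probability.Probability"
begin

type_synonym ('a, 'b) channel = "'a \<Rightarrow> 'b pmf"

definition BSC :: "real \<Rightarrow> (bool, bool) channel" where
  "BSC p x = map_pmf (\<lambda>flip. if flip then \<not> x else x) (bernoulli_pmf p)"

text \<open>The erasure symbol is \<^term>\<open>None\<close>.\<close>

definition BEC :: "real \<Rightarrow> (bool, bool option) channel" where
  "BEC \<epsilon> x = map_pmf (\<lambda>erased. if erased then None else Some x) (bernoulli_pmf \<epsilon>)"

definition words :: "nat \<Rightarrow> 'a list set" where
  "words n = {xs. length xs = n}"

definition product_channel :: "nat \<Rightarrow> ('a, 'b) channel \<Rightarrow> 'a list \<Rightarrow> 'b list \<Rightarrow> real" where
  "product_channel n W xs ys = (\<Prod>i<n. pmf (W (xs ! i)) (ys ! i))"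

datatype shared_randomness = Rate real | Infinite

text \<open>
  The distributions that the shared random variable may have at block length \<open>n\<close>. The number
  of values \<open>2^(nR)\<close> is rounded down to an integer; at rate \<open>0\<close> the variable is constant.
  In the infinite case every finite-valued variable is allowed; taking its values to be natural
  numbers is no restriction, since they can be relabelled.
\<close>

fun shared_distributions :: "shared_randomness \<Rightarrow> nat \<Rightarrow> nat pmf set" where
  "shared_distributions (Rate R) n = {pmf_of_set {1..nat \<lfloor>2 powr (real n * R)\<rfloor>}}"
| "shared_distributions Infinite n = {P. finite (set_pmf P)}"

definition block_map :: "nat \<Rightarrow> 'w pmf \<Rightarrow> ('a list \<Rightarrow> 'w \<Rightarrow> 'b list pmf) \<Rightarrow> bool" where
  "block_map n P q \<longleftrightarrow> (\<forall>xs\<in>words n. \<forall>\<omega>\<in>set_pmf P. set_pmf (q xs \<omega>) \<subseteq> words n)"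

text \<open>Finite alphabets and finite support of \<open>P\<close> make all the sums below finite.\<close>

definition induced_channel ::
  "nat \<Rightarrow> 'w pmf \<Rightarrow> ('a list \<Rightarrow> 'w \<Rightarrow> 'c list pmf) \<Rightarrow> ('c::finite, 'd::finite) channel \<Rightarrow>
    ('d list \<Rightarrow> 'w \<Rightarrow> 'b list pmf) \<Rightarrow> 'a list \<Rightarrow> 'b list \<Rightarrow> real" where
  "induced_channel n P enc U dec xs ys =
    (\<Sum>\<omega>\<in>set_pmf P. pmf P \<omega> *
      (\<Sum>us\<in>words n. \<Sum>vs\<in>words n.
        pmf (enc xs \<omega>) us * product_channel n U us vs * pmf (dec vs \<omega>) ys))"

definition exactly_simulable_from ::
  "shared_randomness \<Rightarrow> ('a::finite, 'b::finite) channel \<Rightarrow> ('c::finite, 'd::finite) channel \<Rightarrow> bool"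
where
  "exactly_simulable_from S W U \<longleftrightarrow>
    (\<exists>n\<ge>1. \<exists>P\<in>shared_distributions S n.
      \<exists>(enc :: 'a list \<Rightarrow> nat \<Rightarrow> 'c list pmf) (dec :: 'd list \<Rightarrow> nat \<Rightarrow> 'b list pmf).
        block_map n P enc \<and> block_map n P dec \<and>
        (\<forall>xs\<in>words n. \<forall>ys\<in>words n.
          induced_channel n P enc U dec xs ys = product_channel n W xs ys))"

end

theory Submission
  imports Defs
begin

text \<open>
  For the converse, all \<open>n\<close> symbols are erased with probability \<open>\<epsilon>^n\<close>, and the decoder output is
  then distributed according to some \<open>r\<close> that does not depend on the input. Feeding the complement
  of a word \<open>y\<close> into the simulated channel yields \<open>p^n \<ge> \<epsilon>^n r(y)\<close>, and summing over the
  \<open>2^n\<close> words \<open>y\<close> yields \<open>(2p)^n \<ge> \<epsilon>^n\<close>. Conversely, a decoder acting on a single symbol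
  suffices: it replaces an erasure by a fair coin and flips an unerased symbol with probability
  \<open>(p - \<epsilon>/2) / (1 - \<epsilon>)\<close>, which is \<open>0\<close> by convention for \<open>\<epsilon> = 1\<close>, where \<open>p = 1/2\<close>.
\<close>

lemma finite_words [simp]: "finite (words n :: 'a::finite list set)"
  using finite_lists_length_eq[of "UNIV :: 'a set" n] by (simp add: words_def)

lemma card_words: "card (words n :: 'a::finite list set) = CARD('a) ^ n"
  using card_lists_length_eq[of "UNIV :: 'a set" n] by (simp add: words_def)

lemma replicate_in_words: "replicate n x \<in> words n"
  by (simp add: words_def)

lemma words_1: "words 1 = range (\<lambda>x. [x])"
  by (auto simp: words_def length_Suc_conv)

lemma sum_words_1: "(\<Sum>xs\<in>words 1. f xs) = (\<Sum>x\<in>UNIV. f [x])"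
  unfolding words_1 by (simp add: sum.reindex inj_on_def)

lemma product_channel_1 [simp]: "product_channel (Suc 0) W [x] [y] = pmf (W x) y"
  by (simp add: product_channel_def)

lemma product_channel_nonneg: "product_channel n W xs ys \<ge> 0"
  by (simp add: product_channel_def prod_nonneg)

lemma sum_pmf_words:
  fixes q :: "'a::finite list pmf"
  assumes "set_pmf q \<subseteq> words n"
  shows "(\<Sum>xs\<in>words n. pmf q xs) = 1"
  using assms by (intro sum_pmf_eq_1) simp_all

text \<open>Among all channel outputs only the constant word \<open>replicate n e\<close> is kept.
  Whatever the encoder sends, that word occurs with probability at least \<open>c ^ n\<close>, so
  what remains is a bound in which the input \<open>xs\<close> no longer appears on the
  left.\<close>

lemma induced_channel_ge:
  fixes U :: "('c::finite, 'd::finite) channel"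
  assumes enc: "block_map n P enc" and xs: "xs \<in> words n"
    and c: "c \<ge> 0" "\<And>u. c \<le> pmf (U u) e"
  shows "c ^ n * (\<Sum>\<omega>\<in>set_pmf P. pmf P \<omega> * pmf (dec (replicate n e) \<omega>) ys)
    \<le> induced_channel n P enc U dec xs ys"
proof -
  have prod: "c ^ n \<le> product_channel n U us (replicate n e)" for us
  proof -
    have "(\<Prod>i<n. c) \<le> (\<Prod>i<n. pmf (U (us ! i)) (replicate n e ! i))"
      using c by (intro prod_mono) auto
    then show ?thesis by (simp add: product_channel_def)
  qed
  have "pmf P \<omega> * (c ^ n * pmf (dec (replicate n e) \<omega>) ys) \<le> pmf P \<omega> *
      (\<Sum>us\<in>words n. \<Sum>vs\<in>words n.
        pmf (enc xs \<omega>) us * product_channel n U us vs * pmf (dec vs \<omega>) ys)"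
    if \<omega>: "\<omega> \<in> set_pmf P" for \<omega>
  proof (intro mult_left_mono)
    let ?d = "pmf (dec (replicate n e) \<omega>) ys"
    \<comment> \<open>The factor 1 is inserted as the total mass of the encoder, to match the shape
      of the induced channel.\<close>
    have "c ^ n * ?d = (\<Sum>us\<in>words n. pmf (enc xs \<omega>) us) * (c ^ n * ?d)"
      using enc xs \<omega> by (subst sum_pmf_words) (auto simp: block_map_def)
    also have "\<dots> = (\<Sum>us\<in>words n. pmf (enc xs \<omega>) us * c ^ n * ?d)"
      by (simp add: sum_distrib_right mult.assoc)
    also have "\<dots> \<le> (\<Sum>us\<in>words n. pmf (enc xs \<omega>) us *
        product_channel n U us (replicate n e) * ?d)"
      using prod by (intro sum_mono mult_right_mono mult_left_mono) auto
    \<comment> \<open>A sum of nonnegative terms over \<open>vs\<close> dominates its term at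
      \<open>replicate n e\<close>.\<close>
    also have "\<dots> \<le> (\<Sum>us\<in>words n. \<Sum>vs\<in>words n.
        pmf (enc xs \<omega>) us * product_channel n U us vs * pmf (dec vs \<omega>) ys)"
      by (intro sum_mono member_le_sum[where f = "\<lambda>vs. _ vs * pmf (dec vs \<omega>) ys"])
        (simp_all add: replicate_in_words product_channel_nonneg)
    finally show "c ^ n * ?d \<le> \<dots>" .
  qed simp
  then show ?thesis
    unfolding induced_channel_def sum_distrib_left by (intro sum_mono) (simp add: mult.left_commute)
qed

text \<open>If \<open>W\<close> is a degraded version of \<open>U\<close>, block length 1 is enough:
  the encoder is the identity, the decoder applies \<open>D\<close>, and both ignore \<omega>. Hence
  any admissible finitely supported \<open>P\<close> will do.\<close>

lemma exactly_simulable_fromI_single_letter: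
  fixes W :: "('a::finite, 'b::finite) channel" and U :: "('a, 'd::finite) channel"
  assumes P: "P \<in> shared_distributions S 1" "finite (set_pmf P)"
    and W: "\<And>x. W x = bind_pmf (U x) D"
  shows "exactly_simulable_from S W U"
proof -
  define enc where "enc = (\<lambda>xs :: 'a list. \<lambda>\<omega>::nat. return_pmf xs)"
  define dec where "dec = (\<lambda>vs :: 'd list. \<lambda>\<omega>::nat. map_pmf (\<lambda>y. [y]) (D (hd vs)))"
  have dec: "pmf (dec [v] \<omega>) [y] = pmf (D v) y" for v \<omega> y
    using pmf_map_inj'[of "\<lambda>y. [y]" "D v" y] by (simp add: dec_def inj_def)
  have "induced_channel 1 P enc U dec [x] [y] = pmf (W x) y" for x y
  proof -
    have "(\<Sum>us\<in>words 1. \<Sum>vs\<in>words 1.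
        pmf (enc [x] \<omega>) us * product_channel 1 U us vs * pmf (dec vs \<omega>) [y])
      = (\<Sum>u\<in>UNIV. if u = x then \<Sum>v\<in>UNIV. pmf (U x) v * pmf (D v) y else 0)" for \<omega>
      unfolding sum_words_1 by (intro sum.cong) (auto simp: enc_def dec pmf_return)
    also have "\<dots> = pmf (W x) y"
      by (simp add: W pmf_bind integral_measure_pmf_real[of UNIV] mult.commute)
    finally show ?thesis
      using P(2) by (simp add: induced_channel_def flip: sum_distrib_right)
        (simp add: sum_pmf_eq_1)
  qed
  moreover have "block_map 1 P enc" "block_map 1 P dec"
    by (auto simp: block_map_def enc_def dec_def words_def)
  ultimately show ?thesis
    unfolding exactly_simulable_from_def using P(1)
    by (intro exI[of _ 1] conjI bexI[of _ P] exI[of _ enc] exI[of _ dec])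
      (auto simp: words_1[simplified])
qed

lemma pmf_BSC:
  assumes "p \<in> {0..1}"
  shows "pmf (BSC p x) y = (if x = y then 1 - p else p)"
  using assms by (auto simp: BSC_def map_pmf_def pmf_bind pmf_return)

lemma pmf_BEC_None:
  assumes "\<epsilon> \<in> {0..1}"
  shows "pmf (BEC \<epsilon> x) None = \<epsilon>"
  using assms by (auto simp: BEC_def map_pmf_def pmf_bind pmf_return)

lemma BSC_eq_bind_BEC:
  assumes p: "p \<in> {0..1/2}" and \<epsilon>: "\<epsilon> \<in> {0..1}" and le: "\<epsilon> / 2 \<le> p"
  obtains D where "\<And>x. BSC p x = bind_pmf (BEC \<epsilon> x) D"
proof
  \<comment> \<open>\<open>q\<close> solves \<epsilon>/2 + (1 - \<epsilon>) q = p, where the left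
    side is the total probability of a wrong output bit. Since p \<le> 1/2, the numerator is at most
    (1 - \<epsilon>)/2, which keeps \<open>q\<close> below 1.\<close>
  define q where "q = (p - \<epsilon> / 2) / (1 - \<epsilon>)"
  have q: "q \<in> {0..1}" and eq: "(1 - \<epsilon>) * q = p - \<epsilon> / 2"
    using p \<epsilon> le by (auto simp: q_def divide_simps)
  fix x
  show "BSC p x = bind_pmf (BEC \<epsilon> x)
    (\<lambda>v. case v of None \<Rightarrow> bernoulli_pmf (1 / 2) | Some b \<Rightarrow> BSC q b)"
  proof (rule pmf_eqI)
    fix y
    show "pmf (BSC p x) y = pmf (bind_pmf (BEC \<epsilon> x)
      (\<lambda>v. case v of None \<Rightarrow> bernoulli_pmf (1 / 2) | Some b \<Rightarrow> BSC q b)) y"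
      using p \<epsilon> q eq
      by (cases y) (auto simp: BEC_def bind_map_pmf pmf_bind pmf_BSC algebra_simps)
  qed
qed

lemma exactly_simulable_BSC_from_BEC:
  assumes "p \<in> {0..1/2}" "\<epsilon> \<in> {0..1}" "\<epsilon> / 2 \<le> p"
    and S: "S \<in> insert Infinite {Rate R | R. R \<ge> 0}"
  shows "exactly_simulable_from S (BSC p) (BEC \<epsilon>)"
proof -
  have "\<exists>P\<in>shared_distributions S 1. finite (set_pmf P)"
  proof (cases S)
    case (Rate R)
    \<comment> \<open>A nonnegative rate gives at least one value of \<omega>; on an empty set
      \<open>pmf_of_set\<close> would be unspecified.\<close>
    with S have "1 \<le> 2 powr R" by (simp add: ge_one_powr_ge_zero)
    then have "{1..nat \<lfloor>2 powr R\<rfloor>} \<noteq> {}" by (simp add: le_nat_iff le_floor_iff)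
    then show ?thesis by (simp add: Rate set_pmf_of_set)
  next
    case Infinite
    then show ?thesis by (auto intro!: exI[of _ "return_pmf 0"])
  qed
  then show ?thesis
    using BSC_eq_bind_BEC[OF assms(1-3)] exactly_simulable_fromI_single_letter by metis
qed

lemma le_if_exactly_simulable_BSC_from_BEC:
  assumes p: "p \<in> {0..1}" and \<epsilon>: "\<epsilon> \<in> {0..1}"
    and S: "S \<in> insert Infinite {Rate R | R. R \<ge> 0}"
    and sim: "exactly_simulable_from S (BSC p) (BEC \<epsilon>)"
  shows "\<epsilon> / 2 \<le> p"
proof -
  obtain n P enc dec where n: "n \<ge> 1" and P: "P \<in> shared_distributions S n"
    and enc: "block_map n P enc" and dec: "block_map n P dec"
    and eq: "\<And>xs ys. xs \<in> words n \<Longrightarrow> ys \<in> words n \<Longrightarrow>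
      induced_channel n P enc (BEC \<epsilon>) dec xs ys = product_channel n (BSC p) xs ys"
    using sim unfolding exactly_simulable_from_def by blast
  \<comment> \<open>Over an infinite support \<open>sum\<close> defaults to 0, so the weights of
    \<open>P\<close> would not add up to 1.\<close>
  have fin: "finite (set_pmf P)"
  proof (cases S)
    case (Rate R)
    with S have "1 \<le> 2 powr (real n * R)" by (simp add: ge_one_powr_ge_zero)
    then have "{1..nat \<lfloor>2 powr (real n * R)\<rfloor>} \<noteq> {}" by (simp add: le_nat_iff le_floor_iff)
    with P show ?thesis by (simp add: Rate set_pmf_of_set)
  qed (use P in simp)
  let ?d = "\<lambda>\<omega>. dec (replicate n None) \<omega>"
  have pointwise: "\<epsilon> ^ n * (\<Sum>\<omega>\<in>set_pmf P. pmf P \<omega> * pmf (?d \<omega>) ys) \<le> p ^ n"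
    if ys: "ys \<in> words n" for ys
  proof -
    have not_ys: "map Not ys \<in> words n" using ys by (simp add: words_def)
    have "\<epsilon> ^ n * (\<Sum>\<omega>\<in>set_pmf P. pmf P \<omega> * pmf (?d \<omega>) ys)
        \<le> induced_channel n P enc (BEC \<epsilon>) dec (map Not ys) ys"
      using \<epsilon> by (intro induced_channel_ge[OF enc not_ys]) (auto simp: pmf_BEC_None)
    also have "\<dots> = product_channel n (BSC p) (map Not ys) ys"
      by (rule eq[OF not_ys ys])
    also have "\<dots> = p ^ n"
      using ys p by (simp add: product_channel_def words_def pmf_BSC)
    finally show ?thesis .
  qed
  \<comment> \<open>Averaging \<open>?d\<close> over \<omega> gives the distribution r of the output
    after a total erasure; its mass is 1.\<close>
  have "(\<Sum>ys\<in>words n. \<Sum>\<omega>\<in>set_pmf P. pmf P \<omega> * pmf (?d \<omega>) ys)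
      = (\<Sum>\<omega>\<in>set_pmf P. pmf P \<omega> * (\<Sum>ys\<in>words n. pmf (?d \<omega>) ys))"
    by (subst sum.swap) (simp add: sum_distrib_left)
  also have "\<dots> = (\<Sum>\<omega>\<in>set_pmf P. pmf P \<omega>)"
    using dec by (intro sum.cong) (simp_all add: block_map_def replicate_in_words sum_pmf_words)
  also have "\<dots> = 1" using fin by (simp add: sum_pmf_eq_1)
  finally have "\<epsilon> ^ n = (\<Sum>ys\<in>words n. \<epsilon> ^ n * (\<Sum>\<omega>\<in>set_pmf P. pmf P \<omega> * pmf (?d \<omega>) ys))"
    by (simp flip: sum_distrib_left)
  also have "\<dots> \<le> (\<Sum>ys\<in>(words n :: bool list set). p ^ n)"
    by (intro sum_mono pointwise)
  also have "\<dots> = (2 * p) ^ n" by (simp add: card_words power_mult_distrib)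
  \<comment> \<open>Taking n-th roots is possible because n \<ge> 1 and both bases are
    nonnegative.\<close>
  finally have "\<epsilon> \<le> 2 * p"
    using p n power_mono_iff[of \<epsilon> "2 * p" n] \<epsilon> by simp
  then show ?thesis by simp
qed

theorem theorem11:
  fixes p \<epsilon> :: real and S :: shared_randomness
  assumes "p \<in> {0..1/2}" and "\<epsilon> \<in> {0..1}"
    and "S \<in> insert Infinite {Rate R | R. R \<ge> 0}"
  shows "(exactly_simulable_from S (BSC p) (BEC \<epsilon>) \<longleftrightarrow> p \<ge> \<epsilon> / 2) \<and>
    (exactly_simulable_from S (BSC p) (BEC \<epsilon>) \<longleftrightarrow>
      exactly_simulable_from (Rate 0) (BSC p) (BEC \<epsilon>))"
proof -
  \<comment> \<open>The criterion does not mention \<open>T\<close>, so using it for both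
    \<open>S\<close> and \<open>Rate 0\<close> also compares the two.\<close>
  have "exactly_simulable_from T (BSC p) (BEC \<epsilon>) \<longleftrightarrow> p \<ge> \<epsilon> / 2"
    if "T \<in> insert Infinite {Rate R | R. R \<ge> 0}" for T
    using exactly_simulable_BSC_from_BEC[OF assms(1,2) _ that]
      le_if_exactly_simulable_BSC_from_BEC[OF _ assms(2) that, of p] assms(1) by auto
  from this[OF assms(3)] this[of "Rate 0"] show ?thesis by auto
qed

end
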